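(* The ideal $\mathcal R$ on $\omega$ generated by the homogeneous sets in some fixed instance of the random graph on $\omega$ is not $\le_K$-homogeneous (in particular, it is not homogeneous).
   Context: An ideal on a set $X$ is a family of subsets of $X$ closed under finite unions and subsets, containing all finite subsets of $X$ and not containing $X$; $\mathcal I^+=\mathcal P(X)\setminus\mathcal I$. The random graph on $\omega$ is the (unique up to isomorphism) countable graph with vertex set $\omega$ such that for any two disjoint finite sets $U,V\subseteq\omega$ there is a vertex outside $U\cup V$ adjacent to all vertices of $U$ and to none of $V$. A set of vertices is homogeneous (in the graph) if it is a clique or an independent set. $\mathcal R$ consists of all subsets of finite unions of homogeneous sets. For ideals $\mathcal I$ on $X$ and $\mathcal K$ on $Y$, $\mathcal I\le_K\mathcal K$ (Katětov order) means that there is $f:Y\to X$ with $f^{-1}[B]\in\mathcal K$ for all $B\in\mathcal I$; $\mathcal I$ and $\mathcal K$ are isomorphic if there is a bijection $f:Y\to X$ with $f^{-1}[B]\in\mathcal K\iff B\in\mathcal I$. For $A\in\mathcal I^+$, $\mathcal I\restriction A=\{B\cap A:B\in\mathcal I\}$ (an ideal on $A$). An ideal $\mathcal I$ is homogeneous if $\mathcal I\restriction A$ is isomorphic to $\mathcal I$ for each $A\in\mathcal I^+$, and $\le_K$-homogeneous if $\mathcal I\restriction A\le_K\mathcal I$ and $\mathcal I\le_K\mathcal I\restriction A$ for each $A\in\mathcal I^+$. *)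

theory Defs
  imports "HOL-Library.FuncSet" "HOL-Library.Ramsey" "HOL-Library.Nat_Bijection"
begin

section \<open>Ideals on a set\<close>

definition ideal_on :: "'a set \<Rightarrow> 'a set set \<Rightarrow> bool" where
  "ideal_on X I \<longleftrightarrow>
     I \<subseteq> Pow X \<and>
     (\<forall>A\<in>I. \<forall>B\<in>I. A \<union> B \<in> I) \<and>
     (\<forall>A\<in>I. \<forall>B. B \<subseteq> A \<longrightarrow> B \<in> I) \<and>
     (\<forall>F. F \<subseteq> X \<and> finite F \<longrightarrow> F \<in> I) \<and>
     X \<notin> I"

definition positive_sets :: "'a set \<Rightarrow> 'a set set \<Rightarrow> 'a set set" where
  "positive_sets X I = Pow X - I"

definition restrict_ideal :: "'a set set \<Rightarrow> 'a set \<Rightarrow> 'a set set" where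
  "restrict_ideal I A = {B \<inter> A | B. B \<in> I}"

text \<open>
  In the following definitions \<open>I\<close> is an ideal on \<open>X\<close> and \<open>K\<close> is an ideal on \<open>Y\<close>.  The witnessing
  function goes from \<open>Y\<close> to \<open>X\<close>, and its preimages are relativised to its domain \<open>Y\<close>.
\<close>

definition katetov_le :: "'a set \<Rightarrow> 'a set set \<Rightarrow> 'b set \<Rightarrow> 'b set set \<Rightarrow> bool" where
  "katetov_le X I Y K \<longleftrightarrow> (\<exists>f \<in> Y \<rightarrow> X. \<forall>B\<in>I. f -` B \<inter> Y \<in> K)"

definition ideal_iso :: "'a set \<Rightarrow> 'a set set \<Rightarrow> 'b set \<Rightarrow> 'b set set \<Rightarrow> bool" where
  "ideal_iso X I Y K \<longleftrightarrow>
     (\<exists>f. bij_betw f Y X \<and> (\<forall>B. B \<subseteq> X \<longrightarrow> (f -` B \<inter> Y \<in> K \<longleftrightarrow> B \<in> I)))"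

definition homogeneous_ideal :: "'a set \<Rightarrow> 'a set set \<Rightarrow> bool" where
  "homogeneous_ideal X I \<longleftrightarrow>
     (\<forall>A\<in>positive_sets X I. ideal_iso A (restrict_ideal I A) X I)"

definition katetov_homogeneous_ideal :: "'a set \<Rightarrow> 'a set set \<Rightarrow> bool" where
  "katetov_homogeneous_ideal X I \<longleftrightarrow>
     (\<forall>A\<in>positive_sets X I.
        katetov_le A (restrict_ideal I A) X I \<and> katetov_le X I A (restrict_ideal I A))"


section \<open>The random graph and its ideal\<close>

text \<open>
  A graph on \<open>\<omega>\<close> is given by its set of edges, each edge being a two-element set of vertices; \<open>clique\<close>
  and \<open>indep\<close> from the Ramsey theory use the same representation.
\<close>

definition random_graph :: "nat set set \<Rightarrow> bool" where
  "random_graph E \<longleftrightarrow>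
     E \<subseteq> [UNIV]\<^bsup>2\<^esup> \<and>
     (\<forall>U V. finite U \<and> finite V \<and> U \<inter> V = {} \<longrightarrow>
        (\<exists>z. z \<notin> U \<union> V \<and> (\<forall>u\<in>U. {z, u} \<in> E) \<and> (\<forall>v\<in>V. {z, v} \<notin> E)))"

definition homogeneous_set :: "'a set set \<Rightarrow> 'a set \<Rightarrow> bool" where
  "homogeneous_set E H \<longleftrightarrow> clique H E \<or> indep H E"

definition random_graph_ideal :: "nat set set \<Rightarrow> nat set set" where
  "random_graph_ideal E =
     {A. \<exists>\<H>. finite \<H> \<and> (\<forall>H\<in>\<H>. homogeneous_set E H) \<and> A \<subseteq> \<Union>\<H>}"


section \<open>Well-definedness\<close>

lemma random_graph_idealI:
  "\<lbrakk>finite F; \<forall>H\<in>F. homogeneous_set E H; A \<subseteq> \<Union>F\<rbrakk> \<Longrightarrow> A \<in> random_graph_ideal E"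
  unfolding random_graph_ideal_def by (intro CollectI exI[of _ F] conjI)

lemma UNIV_notin_random_graph_ideal:
  assumes "random_graph E"
  shows "UNIV \<notin> random_graph_ideal E"
proof
  assume "UNIV \<in> random_graph_ideal E"
  then obtain F where F: "finite F" "\<And>H. H \<in> F \<Longrightarrow> homogeneous_set E H" "\<Union>F = UNIV"
    unfolding random_graph_ideal_def by blast
  define C where "C = {H \<in> F. infinite H \<and> clique H E}"
  define D where "D = {H \<in> F. infinite H \<and> indep H E}"
  define P where "P = \<Union>{H \<in> F. finite H}"
  have fin: "finite C" "finite D" "finite P"
    using F(1) by (auto simp: C_def D_def P_def)
  define x where "x H = (SOME a. a \<in> H)" for H :: "nat set"
  have x: "x H \<in> H" if "H \<in> C" for H
    using that unfolding x_def C_def by (metis (mono_tags, lifting) mem_Collect_eq finite.emptyI ex_in_conv someI_ex)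
  define y where "y H = (SOME a. a \<in> H - x ` C)" for H :: "nat set"
  have y: "y H \<in> H - x ` C" if "H \<in> D" for H
  proof -
    have "H - x ` C \<noteq> {}"
      using that fin(1) by (metis (no_types, lifting) D_def mem_Collect_eq Diff_infinite_finite finite.emptyI finite_imageI)
    then show ?thesis
      unfolding y_def by (metis ex_in_conv someI_ex)
  qed
  define U where "U = y ` D"
  define V where "V = (x ` C \<union> P) - U"
  have "finite U" "finite V" "U \<inter> V = {}"
    using fin by (auto simp: U_def V_def)
  then obtain z where z: "z \<notin> U \<union> V" "\<And>u. u \<in> U \<Longrightarrow> {z, u} \<in> E" "\<And>v. v \<in> V \<Longrightarrow> {z, v} \<notin> E"
    using assms unfolding random_graph_def by meson
  obtain H where H: "H \<in> F" "z \<in> H"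
    using F(3) by blast
  have "z \<notin> P"
    using z(1) by (auto simp: V_def)
  then have "infinite H"
    using H by (auto simp: P_def)
  then consider "H \<in> C" | "H \<in> D"
    using H F(2) by (auto simp: homogeneous_set_def C_def D_def)
  then show False
  proof cases
    case 1
    have "x H \<notin> U"
    proof
      assume "x H \<in> U"
      then obtain H' where "H' \<in> D" "x H = y H'"
        by (auto simp: U_def)
      then show False
        using y[of H'] 1 by (metis DiffD2 imageI)
    qed
    with 1 have V: "x H \<in> V"
      by (simp add: V_def)
    then have "z \<noteq> x H"
      using z(1) by blast
    moreover have "clique H E"
      using 1 by (simp add: C_def)
    ultimately have "{z, x H} \<in> E"
      using x[OF 1] H(2) by (simp add: clique_def)
    with z(3)[OF V] show False
      by simp
  next
    case 2
    then have U: "y H \<in> U"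
      by (simp add: U_def)
    then have "z \<noteq> y H"
      using z(1) by blast
    moreover have "indep H E"
      using 2 by (simp add: D_def)
    ultimately have "{z, y H} \<notin> E"
      using y[OF 2] H(2) by (simp add: indep_def)
    with z(2)[OF U] show False
      by simp
  qed
qed

lemma ideal_on_random_graph_ideal:
  assumes "random_graph E"
  shows "ideal_on UNIV (random_graph_ideal E)"
  unfolding ideal_on_def
proof (intro conjI ballI allI impI)
  fix A B assume "A \<in> random_graph_ideal E" "B \<in> random_graph_ideal E"
  then obtain F G where "finite F" "\<forall>H\<in>F. homogeneous_set E H" "A \<subseteq> \<Union>F"
    "finite G" "\<forall>H\<in>G. homogeneous_set E H" "B \<subseteq> \<Union>G"
    unfolding random_graph_ideal_def by blast
  then have "finite (F \<union> G) \<and> (\<forall>H\<in>F \<union> G. homogeneous_set E H) \<and> A \<union> B \<subseteq> \<Union>(F \<union> G)"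
    by auto
  then show "A \<union> B \<in> random_graph_ideal E"
    using random_graph_idealI by metis
next
  fix F :: "nat set" assume "F \<subseteq> UNIV \<and> finite F"
  then have "finite ((\<lambda>a. {a}) ` F) \<and> (\<forall>H\<in>(\<lambda>a. {a}) ` F. homogeneous_set E H) \<and>
      F \<subseteq> \<Union>((\<lambda>a. {a}) ` F)"
    by (auto simp: homogeneous_set_def clique_def)
  then show "F \<in> random_graph_ideal E"
    using random_graph_idealI by metis
next
  show "UNIV \<notin> random_graph_ideal E"
    using assms by (rule UNIV_notin_random_graph_ideal)
next
  fix A B assume "A \<in> random_graph_ideal E" "B \<subseteq> A"
  then obtain F where "finite F" "\<forall>H\<in>F. homogeneous_set E H" "A \<subseteq> \<Union>F"
    unfolding random_graph_ideal_def by blast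
  then show "B \<in> random_graph_ideal E"
    using \<open>B \<subseteq> A\<close> random_graph_idealI[of F E B] by (meson subset_trans)
qed simp

text \<open>
  Rado's construction: for \<open>m < n\<close>, join \<open>m\<close> to \<open>n\<close> if the \<open>m\<close>-th binary digit of \<open>n\<close> is 1.
\<close>

lemma random_graph_exists: "\<exists>E. random_graph E"
proof
  let ?E = "{{m, n} | m n. m < n \<and> m \<in> set_decode n}"
  show "random_graph ?E"
    unfolding random_graph_def
  proof (intro conjI allI impI)
    show "?E \<subseteq> [UNIV]\<^bsup>2\<^esup>"
      by auto
    fix U V :: "nat set"
    assume UV: "finite U \<and> finite V \<and> U \<inter> V = {}"
    obtain N where N: "\<And>w. w \<in> U \<union> V \<Longrightarrow> w < N"
      using UV by (metis finite_Un finite_nat_bounded lessThan_iff subsetD)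
    define z where "z = set_encode (insert N U)"
    have "N \<notin> U"
      using N by blast
    then have "2 ^ N \<le> z"
      using UV by (simp add: z_def)
    then have "N < z"
      by (meson less_exp order_less_le_trans)
    then have less: "w < z" if "w \<in> U \<union> V" for w
      using N[OF that] by simp
    have adj: "{z, w} \<in> ?E \<longleftrightarrow> w \<in> insert N U" if "w < z" for w
    proof -
      have "{z, w} \<in> ?E \<longleftrightarrow> w \<in> set_decode z"
        using that by (force simp: doubleton_eq_iff)
      then show ?thesis
        using UV by (simp add: z_def)
    qed
    have "z \<notin> U \<union> V"
      using less by blast
    moreover have "{z, u} \<in> ?E" if "u \<in> U" for u
      using adj less that by blast
    moreover have "{z, v} \<notin> ?E" if "v \<in> V" for v
      using adj[of v] less[of v] N[of v] UV that by blast
    ultimately show "\<exists>z. z \<notin> U \<union> V \<and> (\<forall>u\<in>U. {z, u} \<in> ?E) \<and> (\<forall>v\<in>V. {z, v} \<notin> ?E)"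
      by blast
  qed
qed

end

theory Submission
  imports Defs
begin

text \<open>
  Let \<open>\<R>\<close> be the ideal of a random graph \<open>E\<close>.  The random graph contains an induced copy \<open>A\<close> of a
  disjoint union of infinitely many infinite cliques, its \<^emph>\<open>columns\<close>, with no edges between distinct
  columns.  A homogeneous set has two points in at most one column, so finitely many homogeneous
  sets leave almost every column with only finitely many covered points: \<open>A\<close> is positive
  (\<open>columns_notin_random_graph_ideal\<close>).  The claim is that \<open>\<R> \<restriction> A\<close> is not Katetov below \<open>\<R>\<close>;
  this refutes both kinds of homogeneity, as an isomorphism of ideals is a Katetov reduction.

  Suppose \<open>g\<close> maps all vertices to \<open>A\<close> so that preimages of sets in \<open>\<R> \<restriction> A\<close> are in \<open>\<R>\<close>.  Columns are
  cliques, so the preimages of the columns partition the vertices into sets of \<open>\<R>\<close>.  A subset of \<open>A\<close>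
  meeting each column at most once is independent, so every set \<open>S\<close> of vertices that meets each piece
  of the partition at most once is in \<open>\<R>\<close>, being contained in the preimage of \<open>g ` S\<close>.  But \<open>\<R>\<close> does not
  have this property: for any partition into sets of \<open>\<R>\<close> there is an induced copy of the whole random
  graph that meets each piece at most once, and no copy of the random graph is in \<open>\<R>\<close>.

  The copy is built one vertex at a time (\<open>random_graph_embedding_avoiding\<close>).  A new vertex must have
  a prescribed adjacency to the finitely many earlier ones and avoid finitely many pieces, whose
  union is in \<open>\<R>\<close>.  This is possible because the vertices realising a prescribed finite adjacency
  pattern always form a positive set (\<open>pattern_set_notin_random_graph_ideal\<close>).
\<close>

section \<open>Vertices with a prescribed finite adjacency pattern\<close>

definition pattern_set :: "'a set set \<Rightarrow> 'a set \<Rightarrow> 'a set \<Rightarrow> 'a set" where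
  "pattern_set E U V = {z. z \<notin> U \<union> V \<and> (\<forall>u\<in>U. {z, u} \<in> E) \<and> (\<forall>v\<in>V. {z, v} \<notin> E)}"

text \<open>
  One homogeneous set at a time can be discarded from a cover: if \<open>h\<close> lies both in the pattern set
  and in a clique \<open>H\<close>, the vertices of the pattern set that are also not joined to \<open>h\<close> all lie
  outside \<open>H\<close>, and they form a pattern set again.  For an independent \<open>H\<close>, take those joined to \<open>h\<close>.
\<close>

lemma pattern_set_not_covered:
  assumes "random_graph E" and "finite \<H>" and "\<forall>H\<in>\<H>. homogeneous_set E H"
    and "finite U" "finite V" "U \<inter> V = {}"
  shows "\<not> pattern_set E U V \<subseteq> \<Union>\<H>"
  using assms(2-)
proof (induction \<H> arbitrary: U V rule: finite_induct)
  case empty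
  then show ?case
    using assms(1) unfolding random_graph_def pattern_set_def by simp
next
  case (insert H \<H>)
  show ?case
  proof
    assume cover: "pattern_set E U V \<subseteq> \<Union>(insert H \<H>)"
    have "\<not> pattern_set E U V \<subseteq> \<Union>\<H>"
      using insert by simp
    with cover obtain h where h: "h \<in> H" "h \<in> pattern_set E U V"
      by blast
    have fresh: "h \<notin> U" "h \<notin> V"
      using h(2) by (auto simp: pattern_set_def)
    consider "clique H E" | "indep H E"
      using insert.prems(1) by (auto simp: homogeneous_set_def)
    then show False
    proof cases
      case 1
      have "z \<notin> H" if "z \<in> pattern_set E U (insert h V)" for z
        using 1 h(1) that by (auto simp: clique_def pattern_set_def)
      moreover have "pattern_set E U (insert h V) \<subseteq> pattern_set E U V"
        by (auto simp: pattern_set_def)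
      ultimately have "pattern_set E U (insert h V) \<subseteq> \<Union>\<H>"
        using cover by blast
      then show False
        using insert.IH[of U "insert h V"] insert.prems fresh by simp
    next
      case 2
      have "z \<notin> H" if "z \<in> pattern_set E (insert h U) V" for z
        using 2 h(1) that by (auto simp: indep_def pattern_set_def)
      moreover have "pattern_set E (insert h U) V \<subseteq> pattern_set E U V"
        by (auto simp: pattern_set_def)
      ultimately have "pattern_set E (insert h U) V \<subseteq> \<Union>\<H>"
        using cover by blast
      then show False
        using insert.IH[of "insert h U" V] insert.prems fresh by simp
    qed
  qed
qed

lemma pattern_set_notin_random_graph_ideal:
  assumes "random_graph E" and "finite U" "finite V" "U \<inter> V = {}"
  shows "pattern_set E U V \<notin> random_graph_ideal E"
  using pattern_set_not_covered[OF assms(1) _ _ assms(2-)]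
  by (auto simp: random_graph_ideal_def)

section \<open>Embedding graphs while avoiding sets of the ideal\<close>

lemma random_graph_ideal_subset:
  assumes "A \<in> random_graph_ideal E" "B \<subseteq> A"
  shows "B \<in> random_graph_ideal E"
proof -
  obtain \<H> where "finite \<H>" "\<forall>H\<in>\<H>. homogeneous_set E H" "A \<subseteq> \<Union>\<H>"
    using assms(1) unfolding random_graph_ideal_def by blast
  then show ?thesis
    using assms(2) by (meson random_graph_idealI subset_trans)
qed

lemma random_graph_ideal_Union:
  assumes "random_graph E" "finite \<A>" "\<A> \<subseteq> random_graph_ideal E"
  shows "\<Union>\<A> \<in> random_graph_ideal E"
  using assms(2,3)
proof (induction rule: finite_induct)
  case empty
  show ?case
    using ideal_on_random_graph_ideal[OF assms(1)] by (auto simp: ideal_on_def)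
next
  case (insert A \<A>)
  then show ?case
    using ideal_on_random_graph_ideal[OF assms(1)] by (auto simp: ideal_on_def)
qed

lemma homogeneous_set_in_random_graph_ideal:
  "homogeneous_set E H \<Longrightarrow> H \<in> random_graph_ideal E"
  using random_graph_idealI[of "{H}" E H] by simp

text \<open>
  A version of the universality of the random graph: every graph on the natural numbers, given by
  \<open>G i j\<close> for \<open>i < j\<close>, embeds as an induced subgraph, even when each vertex already chosen forbids a set
  of the ideal to the later ones.
\<close>

lemma random_graph_embedding_avoiding:
  fixes G :: "nat \<Rightarrow> nat \<Rightarrow> bool"
  assumes E: "random_graph E" and P: "\<And>v. P v \<in> random_graph_ideal E"
  obtains x :: "nat \<Rightarrow> nat" where "inj x"
    "\<And>i j. i < j \<Longrightarrow> {x j, x i} \<in> E \<longleftrightarrow> G i j"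
    "\<And>i j. i < j \<Longrightarrow> x j \<notin> P (x i)"
proof -
  define Q where "Q x n z \<longleftrightarrow>
    (\<forall>i<n. z \<noteq> x i \<and> ({z, x i} \<in> E \<longleftrightarrow> G i n) \<and> z \<notin> P (x i))" for x :: "nat \<Rightarrow> nat" and n z
  have "\<exists>x. \<forall>n. Q x n (x n)"
  proof (rule dependent_wf_choice[OF wf_less_than])
    show "Q x n z = Q y n z" if "\<And>m. (m, n) \<in> less_than \<Longrightarrow> x m = y m" for x y n z
      using that by (simp add: Q_def)
  next
    fix n x
    assume IH: "\<And>m. (m, n) \<in> less_than \<Longrightarrow> Q x m (x m)"
    \<comment> \<open>Distinctness of the earlier vertices makes the pattern asked of the new one consistent.\<close>
    have inj: "inj_on x {..<n}"
      by (rule linorder_inj_onI) (use IH in \<open>fastforce simp: Q_def\<close>)+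
    define U where "U = x ` {i. i < n \<and> G i n}"
    define V where "V = x ` {i. i < n \<and> \<not> G i n}"
    have "finite U" "finite V"
      by (auto simp: U_def V_def)
    moreover have "U \<inter> V = {}"
      using inj by (auto simp: U_def V_def inj_on_def)
    ultimately have "pattern_set E U V \<notin> random_graph_ideal E"
      using pattern_set_notin_random_graph_ideal[OF E] by blast
    moreover have "\<Union>((\<lambda>i. P (x i)) ` {..<n}) \<in> random_graph_ideal E"
      by (rule random_graph_ideal_Union[OF E]) (use P in auto)
    ultimately have "\<not> pattern_set E U V \<subseteq> \<Union>((\<lambda>i. P (x i)) ` {..<n})"
      using random_graph_ideal_subset by metis
    then obtain z where "z \<in> pattern_set E U V" "\<forall>i<n. z \<notin> P (x i)"
      by auto
    then have "Q x n z"
      by (auto simp: Q_def pattern_set_def U_def V_def)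
    then show "\<exists>z. Q x n z" ..
  qed
  then obtain x where x: "\<And>n. Q x n (x n)"
    by blast
  have "inj x"
    by (rule linorder_injI) (use x in \<open>fastforce simp: Q_def\<close>)
  then show thesis
    using that x by (simp add: Q_def)
qed

section \<open>Disjoint unions of infinite cliques\<close>

text \<open>
  The function \<open>c\<close> sends a vertex of \<open>A\<close> to its column.  A homogeneous set with two points in one column
  contains an edge, hence is a clique and stays inside that column.  So a finite cover by homogeneous
  sets would leave a column that each of them meets in at most one point.
\<close>

lemma columns_notin_random_graph_ideal:
  fixes c :: "nat \<Rightarrow> nat"
  assumes edges: "\<And>a b. a \<in> A \<Longrightarrow> b \<in> A \<Longrightarrow> a \<noteq> b \<Longrightarrow> {a, b} \<in> E \<longleftrightarrow> c a = c b"
    and columns: "\<And>k. infinite {a \<in> A. c a = k}"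
  shows "A \<notin> random_graph_ideal E"
proof
  assume "A \<in> random_graph_ideal E"
  then obtain \<H> where \<H>: "finite \<H>" "\<And>H. H \<in> \<H> \<Longrightarrow> homogeneous_set E H" "A \<subseteq> \<Union>\<H>"
    unfolding random_graph_ideal_def by blast
  define double where "double H = {k. \<exists>a\<in>A \<inter> H. \<exists>b\<in>A \<inter> H. a \<noteq> b \<and> c a = k \<and> c b = k}" for H
  have "finite (double H)" if "H \<in> \<H>" for H
  proof -
    have "k = l" if "k \<in> double H" "l \<in> double H" for k l
    proof -
      obtain a b where a: "a \<in> A \<inter> H" "b \<in> A \<inter> H" "a \<noteq> b" "c a = k" "c b = k"
        using \<open>k \<in> double H\<close> unfolding double_def by blast
      obtain d where d: "d \<in> A \<inter> H" "c d = l"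
        using \<open>l \<in> double H\<close> unfolding double_def by blast
      have "\<not> indep H E"
        using a edges[of a b] by (auto simp: indep_def)
      then have "clique H E"
        using \<H>(2)[OF \<open>H \<in> \<H>\<close>] by (simp add: homogeneous_set_def)
      then show "k = l"
        using a d edges[of a d] by (cases "a = d") (auto simp: clique_def)
    qed
    then have "\<exists>k. double H \<subseteq> {k}"
      by blast
    then show ?thesis
      using finite_subset by blast
  qed
  then have "finite (\<Union>(double ` \<H>))"
    using \<H>(1) by blast
  then obtain k where k: "k \<notin> \<Union>(double ` \<H>)"
    by (rule ex_new_if_finite[OF infinite_UNIV_nat, THEN exE])
  have "finite ({a \<in> A. c a = k} \<inter> H)" if "H \<in> \<H>" for H
  proof -
    have "k \<notin> double H"
      using k that by blast
    then have "a = b" if "a \<in> {a \<in> A. c a = k} \<inter> H" "b \<in> {a \<in> A. c a = k} \<inter> H" for a b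
      using that by (auto simp: double_def)
    then have "\<exists>a. {a \<in> A. c a = k} \<inter> H \<subseteq> {a}"
      by blast
    then show ?thesis
      using finite_subset by blast
  qed
  then have "finite (\<Union>H\<in>\<H>. {a \<in> A. c a = k} \<inter> H)"
    using \<H>(1) by blast
  moreover have "{a \<in> A. c a = k} \<subseteq> (\<Union>H\<in>\<H>. {a \<in> A. c a = k} \<inter> H)"
    using \<H>(3) by blast
  ultimately show False
    using columns finite_subset by blast
qed

lemma induced_copy_notin_random_graph_ideal:
  assumes E: "random_graph E" and "inj y"
    and copy: "\<And>i j. i \<noteq> j \<Longrightarrow> {y i, y j} \<in> E \<longleftrightarrow> {i, j} \<in> E"
  shows "range y \<notin> random_graph_ideal E"
proof
  assume "range y \<in> random_graph_ideal E"
  then obtain \<H> where \<H>: "finite \<H>" "\<forall>H\<in>\<H>. homogeneous_set E H" "range y \<subseteq> \<Union>\<H>"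
    unfolding random_graph_ideal_def by blast
  have "homogeneous_set E (y -` H)" if "H \<in> \<H>" for H
  proof -
    have "homogeneous_set E H"
      using \<H>(2) that by blast
    moreover have "clique (y -` H) E" if "clique H E"
      unfolding clique_def
    proof (intro ballI impI)
      fix i j assume "i \<in> y -` H" "j \<in> y -` H" "i \<noteq> j"
      then show "{i, j} \<in> E"
        using that copy[of i j] by (auto simp: clique_def inj_eq[OF \<open>inj y\<close>])
    qed
    moreover have "indep (y -` H) E" if "indep H E"
      unfolding indep_def
    proof (intro ballI impI)
      fix i j assume "i \<in> y -` H" "j \<in> y -` H" "i \<noteq> j"
      then show "{i, j} \<notin> E"
        using that copy[of i j] by (auto simp: indep_def inj_eq[OF \<open>inj y\<close>])
    qed
    ultimately show ?thesis
      by (auto simp: homogeneous_set_def)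
  qed
  moreover have "UNIV \<subseteq> \<Union>((\<lambda>H. y -` H) ` \<H>)"
    using \<H>(3) by blast
  ultimately have "UNIV \<in> random_graph_ideal E"
    using \<H>(1) by (intro random_graph_idealI[of "(\<lambda>H. y -` H) ` \<H>"]) auto
  then show False
    using UNIV_notin_random_graph_ideal[OF E] by blast
qed

text \<open>
  A vertex \<open>v\<close> of the copy built below forbids all vertices that \<open>g\<close> sends to the column of \<open>g v\<close>.  The
  image of the copy then has one point in each column that it meets, so it is independent.
\<close>

lemma columns_not_katetov_le_random_graph_ideal:
  fixes c :: "nat \<Rightarrow> nat"
  assumes E: "random_graph E"
    and edges: "\<And>a b. a \<in> A \<Longrightarrow> b \<in> A \<Longrightarrow> a \<noteq> b \<Longrightarrow> {a, b} \<in> E \<longleftrightarrow> c a = c b"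
  shows "\<not> katetov_le A (restrict_ideal (random_graph_ideal E) A) UNIV (random_graph_ideal E)"
proof
  assume "katetov_le A (restrict_ideal (random_graph_ideal E) A) UNIV (random_graph_ideal E)"
  then obtain g where g: "\<And>v. g v \<in> A"
    and pre: "\<And>B. B \<in> restrict_ideal (random_graph_ideal E) A \<Longrightarrow> g -` B \<in> random_graph_ideal E"
    unfolding katetov_le_def by auto
  have pre': "g -` B \<in> random_graph_ideal E" if "homogeneous_set E B" "B \<subseteq> A" for B
    using that homogeneous_set_in_random_graph_ideal
    by (intro pre) (auto simp: restrict_ideal_def)
  have piece: "{w. c (g w) = c (g v)} \<in> random_graph_ideal E" for v
  proof -
    have "clique {a \<in> A. c a = c (g v)} E"
      using edges by (simp add: clique_def)
    then have "g -` {a \<in> A. c a = c (g v)} \<in> random_graph_ideal E"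
      by (intro pre') (auto simp: homogeneous_set_def)
    then show ?thesis
      using g by (simp add: vimage_def)
  qed
  obtain y where y: "inj y" "\<And>i j. i < j \<Longrightarrow> {y j, y i} \<in> E \<longleftrightarrow> {i, j} \<in> E"
      "\<And>i j. i < j \<Longrightarrow> y j \<notin> {w. c (g w) = c (g (y i))}"
    by (rule random_graph_embedding_avoiding[OF E, where P = "\<lambda>v. {w. c (g w) = c (g v)}"
          and G = "\<lambda>i j. {i, j} \<in> E", OF piece]) (rule that)
  have sel: "c (g (y i)) \<noteq> c (g (y j))" if "i \<noteq> j" for i j
    using that y(3)[of i j] y(3)[of j i] by (cases "i < j") auto
  have "indep (range (\<lambda>i. g (y i))) E"
    unfolding indep_def
  proof (intro ballI impI)
    fix a b assume "a \<in> range (\<lambda>i. g (y i))" "b \<in> range (\<lambda>i. g (y i))" "a \<noteq> b"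
    then obtain i j where "a = g (y i)" "b = g (y j)" "i \<noteq> j"
      by blast
    then show "{a, b} \<notin> E"
      using sel[of i j] edges[of a b] g \<open>a \<noteq> b\<close> by simp
  qed
  then have "g -` range (\<lambda>i. g (y i)) \<in> random_graph_ideal E"
    using g by (intro pre') (auto simp: homogeneous_set_def)
  then have "range y \<in> random_graph_ideal E"
    by (rule random_graph_ideal_subset) auto
  moreover have "{y i, y j} \<in> E \<longleftrightarrow> {i, j} \<in> E" if "i \<noteq> j" for i j
    using that y(2)[of i j] y(2)[of j i] by (cases "i < j") (auto simp: insert_commute)
  ultimately show False
    using induced_copy_notin_random_graph_ideal[OF E y(1)] by blast
qed

text \<open>
  The columns are indexed by the first component of the pairing function, so that each of them is
  infinite.
\<close>

lemma random_graph_has_columns: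
  assumes E: "random_graph E"
  obtains A :: "nat set" and c :: "nat \<Rightarrow> nat" where
    "\<And>a b. a \<in> A \<Longrightarrow> b \<in> A \<Longrightarrow> a \<noteq> b \<Longrightarrow> {a, b} \<in> E \<longleftrightarrow> c a = c b"
    "\<And>k. infinite {a \<in> A. c a = k}"
proof -
  define col where "col n = fst (prod_decode n)" for n
  have "{} \<in> random_graph_ideal E"
    using random_graph_idealI[of "{}" E "{}"] by simp
  then obtain x where x: "inj x" "\<And>i j. i < j \<Longrightarrow> {x j, x i} \<in> E \<longleftrightarrow> col i = col j"
    by (rule random_graph_embedding_avoiding[OF E, where P = "\<lambda>_. {}"
          and G = "\<lambda>i j. col i = col j"]) (rule that)
  define c where "c a = col (inv x a)" for a
  have c: "c (x i) = col i" for i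
    using x(1) by (simp add: c_def)
  have edges: "{x i, x j} \<in> E \<longleftrightarrow> col i = col j" if "i \<noteq> j" for i j
    using that x(2)[of i j] x(2)[of j i] by (cases "i < j") (auto simp: insert_commute)
  have "infinite {a \<in> range x. c a = k}" for k
  proof -
    have "inj (\<lambda>m. x (prod_encode (k, m)))"
      by (rule injI) (simp add: inj_eq[OF x(1)] prod_encode_eq)
    then have "infinite (range (\<lambda>m. x (prod_encode (k, m))))"
      by (rule range_inj_infinite)
    moreover have "range (\<lambda>m. x (prod_encode (k, m))) \<subseteq> {a \<in> range x. c a = k}"
      by (auto simp: c col_def)
    ultimately show ?thesis
      using finite_subset by blast
  qed
  moreover have "{a, b} \<in> E \<longleftrightarrow> c a = c b" if "a \<in> range x" "b \<in> range x" "a \<noteq> b" for a b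
  proof -
    obtain i j where "a = x i" "b = x j"
      using \<open>a \<in> range x\<close> \<open>b \<in> range x\<close> by blast
    then show ?thesis
      using edges[of i j] c \<open>a \<noteq> b\<close> by auto
  qed
  ultimately show thesis
    by (rule that[rotated])
qed

section \<open>Failure of homogeneity\<close>

lemma ideal_iso_imp_katetov_le:
  assumes "ideal_iso X I Y K" and "I \<subseteq> Pow X"
  shows "katetov_le X I Y K"
proof -
  obtain f where f: "bij_betw f Y X" "\<And>B. B \<subseteq> X \<Longrightarrow> f -` B \<inter> Y \<in> K \<longleftrightarrow> B \<in> I"
    using assms(1) unfolding ideal_iso_def by blast
  show ?thesis
    unfolding katetov_le_def
    using f assms(2) by (intro bexI[of _ f]) (auto dest: bij_betw_imp_funcset)
qed

theorem proposition10p4: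
  fixes E :: "nat set set"
  assumes "random_graph E"
  shows "\<not> katetov_homogeneous_ideal UNIV (random_graph_ideal E) \<and>
         \<not> homogeneous_ideal UNIV (random_graph_ideal E)"
proof -
  obtain A :: "nat set" and c :: "nat \<Rightarrow> nat" where
    A: "\<And>a b. a \<in> A \<Longrightarrow> b \<in> A \<Longrightarrow> a \<noteq> b \<Longrightarrow> {a, b} \<in> E \<longleftrightarrow> c a = c b"
    and columns: "\<And>k. infinite {a \<in> A. c a = k}"
    using random_graph_has_columns[OF assms] by metis
  have pos: "A \<in> positive_sets UNIV (random_graph_ideal E)"
    using columns_notin_random_graph_ideal[OF A columns] by (simp add: positive_sets_def)
  have not_le: "\<not> katetov_le A (restrict_ideal (random_graph_ideal E) A) UNIV (random_graph_ideal E)"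
    using columns_not_katetov_le_random_graph_ideal[OF assms A] by blast
  moreover have "\<not> ideal_iso A (restrict_ideal (random_graph_ideal E) A) UNIV (random_graph_ideal E)"
    using not_le ideal_iso_imp_katetov_le by (force simp: restrict_ideal_def)
  ultimately show ?thesis
    using pos unfolding katetov_homogeneous_ideal_def homogeneous_ideal_def by blast
qed

end
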